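(* Let $\epsilon\in(0,1)$. For each integer $N\geq \exp(\exp(1.842/\epsilon))$, \[ \#\left\{ n\leq N : \tau(n) \geq \log(N)^{\log(2)(1-\epsilon)}\right\} \geq N\left(1 - \frac{85.165}{\epsilon^2\log\log(N)}\right). \]
   Context: $\tau(n)$ denotes the number of positive divisors of the positive integer $n$; $\log$ is the natural logarithm; the set counted consists of positive integers $n\le N$. *)

theory Defs
  imports Complex_Main
begin

definition tau :: "nat \<Rightarrow> nat" where
  "tau n = card {d. d dvd n}"  (* note: tau 0 = 0, since the set is then infinite *)

end

theory Submission
  imports Defs "HOL-Analysis.Harmonic_Numbers" "HOL-Computational_Algebra.Squarefree"
begin

text \<open>
  Let \<open>\<omega>(n)\<close> be the number of distinct primes dividing \<open>n\<close>. Since \<open>\<tau>(n) \<ge> 2 ^ \<omega>(n)\<close>, it suffices to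
  bound the number of \<open>n \<le> N\<close> with \<open>\<omega>(n) < (1 - \<epsilon>) L\<close>, where \<open>L = log log N\<close>. With \<open>A\<close> the sum
  of \<open>1 / p\<close> over the primes \<open>p \<le> N\<close>, expanding the square gives Turan's inequality in the form
  \<open>\<Sum>n\<le>N. (\<omega>(n) - A)\<^sup>2 \<le> 3 N A\<close>, and writing \<open>n\<close> as a squarefree number times a square gives
  \<open>log N \<le> 2 exp A\<close>, hence \<open>A \<ge> L - 1\<close>. The claim is trivial unless \<open>\<epsilon>\<^sup>2 L > 85.165\<close>, and in that
  range Chebyshev's inequality yields it with room to spare.
\<close>

section \<open>Divisors from sets of prime factors\<close>

text \<open>Each subset of the prime factors of \<open>n\<close> has a product dividing
  \<open>n\<close>, and by unique factorization different subsets have different products.\<close>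

lemma two_power_card_prime_factors_le_tau:
  assumes "n > 0"
  shows "2 ^ card (prime_factors n) \<le> tau n"
proof -
  have pf: "prime_factors (\<Prod>S) = S" if "S \<subseteq> prime_factors n" for S :: "nat set"
  proof -
    have fin: "finite S" using that finite_subset by blast
    have pr: "prime p" if "p \<in> S" for p using that \<open>S \<subseteq> prime_factors n\<close> by auto
    have "0 \<notin> S" using pr by force
    then have "prime_factors (\<Prod>S) = (\<Union>p\<in>S. prime_factors p)"
      using prime_factors_prod[OF fin, of "\<lambda>p. p"] by simp
    also have "\<dots> = (\<Union>p\<in>S. {p})"
      using pr by (intro SUP_cong) (auto simp: prime_prime_factors)
    finally show ?thesis by simp
  qed
  have "\<Prod>S dvd n" if "S \<subseteq> prime_factors n" for S
  proof -
    have "\<Prod>S dvd \<Prod>(prime_factors n)"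
      using that by (intro prod_dvd_prod_subset) auto
    also have "\<dots> dvd (\<Prod>p\<in>prime_factors n. p ^ multiplicity p n)"
      by (intro prod_dvd_prod dvd_power) (auto simp: prime_factors_multiplicity)
    also have "\<dots> = n" using assms by (simp add: prod_prime_factors)
    finally show ?thesis .
  qed
  then have "(\<lambda>S. \<Prod>S) ` Pow (prime_factors n) \<subseteq> {d. d dvd n}" by auto
  moreover have "inj_on (\<lambda>S. \<Prod>S) (Pow (prime_factors n))"
    by (rule inj_on_inverseI[where g = prime_factors]) (use pf in auto)
  moreover have "finite {d. d dvd n}" using assms by simp
  ultimately have "card (Pow (prime_factors n)) \<le> card {d. d dvd n}"
    using card_inj_on_le by blast
  then show ?thesis by (simp add: card_Pow tau_def)
qed

section \<open>The second moment of the number of prime divisors\<close>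

lemma card_multiples:
  assumes "d > 0"
  shows "card {n \<in> {1..N}. d dvd n} = N div d"
proof -
  have "{n \<in> {1..N}. d dvd n} = (\<lambda>k. d * k) ` {1..N div d}" (is "?A = ?B")
  proof
    show "?A \<subseteq> ?B"
    proof
      fix n assume n: "n \<in> ?A"
      then obtain k where k: "n = d * k" by auto
      with n assms have "k \<in> {1..N div d}"
        by (auto simp: less_eq_div_iff_mult_less_eq mult.commute)
      with k show "n \<in> ?B" by blast
    qed
    show "?B \<subseteq> ?A"
      using assms by (auto simp: less_eq_div_iff_mult_less_eq mult.commute)
  qed
  moreover have "inj_on (\<lambda>k. d * k) {1..N div d}"
    using assms by (auto intro: inj_onI)
  ultimately show ?thesis by (simp add: card_image)
qed

text \<open>After expanding the square, the terms \<open>N * A\<^sup>2\<close> cancel. What remains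
  is \<open>N * A\<close> from the pairs \<open>p = q\<close> and \<open>2 * N * A\<close> from
  rounding in the first moment.\<close>

lemma turan_inequality:
  fixes P :: "nat set" and N :: nat
  assumes P: "P \<subseteq> {p. prime p \<and> p \<le> N}"
  defines "A \<equiv> (\<Sum>p\<in>P. 1 / real p)"
  shows "(\<Sum>n=1..N. (real (card {p \<in> P. p dvd n}) - A)\<^sup>2) \<le> 3 * real N * A"
proof -
  have sub: "P \<subseteq> {1..N}" using P by (auto simp: prime_ge_Suc_0_nat)
  then have fin: "finite P" using finite_subset by blast
  have cardP: "real (card P) \<le> real N" using card_mono[OF _ sub] by simp
  have A0: "A \<ge> 0" unfolding A_def by (intro sum_nonneg) auto
  define w where "w n = (\<Sum>p\<in>P. of_bool (p dvd n) :: real)" for n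
  have w: "real (card {p \<in> P. p dvd n}) = w n" for n
    using fin by (simp add: w_def of_bool_def sum.If_cases Int_def)
  have count: "(\<Sum>n=1..N. of_bool (d dvd n) :: real) = real (N div d)" if "d > 0" for d
    using card_multiples[OF that, of N] by (simp add: of_bool_def sum.If_cases Int_def)
  have first: "(\<Sum>n=1..N. w n) \<ge> real N * A - real N"
  proof -
    \<comment> \<open>Rounding costs at most 1 per prime, hence at most
      \<open>card P \<le> N\<close> in total.\<close>
    have "real N * A - real N \<le> (\<Sum>p\<in>P. real N / real p - 1)"
      using cardP by (simp add: sum_subtractf A_def sum_distrib_left)
    also have "\<dots> \<le> (\<Sum>p\<in>P. real (N div p))"
    proof (rule sum_mono)
      fix p assume "p \<in> P"
      show "real N / real p - 1 \<le> real (N div p)"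
        using floor_divide_of_nat_eq[of N p, where 'a = real] by linarith
    qed
    also have "\<dots> = (\<Sum>p\<in>P. \<Sum>n=1..N. of_bool (p dvd n))"
      by (intro sum.cong refl count[symmetric]) (use sub in auto)
    also have "\<dots> = (\<Sum>n=1..N. w n)"
      unfolding w_def by (rule sum.swap)
    finally show ?thesis .
  qed
  have second: "(\<Sum>n=1..N. (w n)\<^sup>2) \<le> real N * A\<^sup>2 + real N * A"
  proof -
    have "(\<Sum>n=1..N. (w n)\<^sup>2) =
        (\<Sum>n=1..N. \<Sum>p\<in>P. \<Sum>q\<in>P. of_bool (p dvd n) * of_bool (q dvd n))"
      by (simp add: w_def power2_eq_square sum_product)
    also have "\<dots> = (\<Sum>p\<in>P. \<Sum>n=1..N. \<Sum>q\<in>P. of_bool (p dvd n) * of_bool (q dvd n))"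
      by (rule sum.swap)
    also have "\<dots> = (\<Sum>p\<in>P. \<Sum>q\<in>P. \<Sum>n=1..N. of_bool (p dvd n) * of_bool (q dvd n))"
      by (intro sum.cong refl sum.swap)
    \<comment> \<open>The product term is kept on the diagonal too, so that the double sum factors
      as \<open>A\<^sup>2\<close>.\<close>
    also have "\<dots> \<le> (\<Sum>p\<in>P. \<Sum>q\<in>P. real N * (1 / real p * (1 / real q)) +
        (if p = q then real N * (1 / real p) else 0))"
    proof (intro sum_mono)
      fix p q assume pq: "p \<in> P" "q \<in> P"
      then have pos: "p > 0" "q > 0" using sub by force+
      show "(\<Sum>n=1..N. of_bool (p dvd n) * of_bool (q dvd n)) \<le>
        real N * (1 / real p * (1 / real q)) + (if p = q then real N * (1 / real p) else 0)"
      proof (cases "p = q")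
        case True
        have "(\<Sum>n=1..N. of_bool (p dvd n) * of_bool (q dvd n)) = real (N div p)"
          using count[OF pos(1)] True by (simp flip: of_bool_conj)
        also have "\<dots> \<le> real N * (1 / real p)"
          using of_nat_div_le_of_nat[of N p, where 'a = real] by simp
        also have "\<dots> \<le> real N * (1 / real p * (1 / real q)) + real N * (1 / real p)" by simp
        finally show ?thesis using True by (simp only: if_True simp_thms)
      next
        case False
        then have "coprime p q" using pq P by (auto intro: primes_coprime)
        then have "p dvd n \<and> q dvd n \<longleftrightarrow> p * q dvd n" for n
          by (auto intro: divides_mult dvd_trans)
        then have "(\<Sum>n=1..N. of_bool (p dvd n) * of_bool (q dvd n)) = real (N div (p * q))"
          using count[of "p * q"] pos by (simp flip: of_bool_conj)
        also have "\<dots> \<le> real N * (1 / real p * (1 / real q))"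
          using of_nat_div_le_of_nat[of N "p * q", where 'a = real] by simp
        finally show ?thesis using False by simp
      qed
    qed
    also have "\<dots> = real N * A\<^sup>2 + real N * A"
      unfolding A_def power2_eq_square sum_product using fin
      by (simp add: sum.distrib sum_distrib_left)
    finally show ?thesis .
  qed
  have "(\<Sum>n=1..N. (w n - A)\<^sup>2) = (\<Sum>n=1..N. (w n)\<^sup>2) - 2 * A * (\<Sum>n=1..N. w n) + real N * A\<^sup>2"
    by (simp add: power2_diff sum.distrib sum_subtractf sum_distrib_left algebra_simps)
  also have "\<dots> \<le> (real N * A\<^sup>2 + real N * A) - 2 * A * (real N * A - real N) + real N * A\<^sup>2"
    using first second A0 by (intro add_mono diff_mono mult_left_mono) auto
  also have "\<dots> = 3 * real N * A" by (simp add: power2_eq_square algebra_simps)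
  finally show ?thesis by (simp add: w)
qed

section \<open>A lower bound for the sum of reciprocals of primes\<close>

lemma sum_inverse_squares_le_2: "(\<Sum>m=1..N. 1 / (real m)\<^sup>2) \<le> 2"
proof -
  \<comment> \<open>The subtracted term makes the induction close, by telescoping.\<close>
  have "(\<Sum>m=1..Suc k. 1 / (real m)\<^sup>2) \<le> 2 - 1 / real (Suc k)" for k
  proof (induction k)
    case (Suc k)
    have "1 / (real (Suc (Suc k)))\<^sup>2 \<le> 1 / real (Suc k) - 1 / real (Suc (Suc k))"
      by (simp add: divide_simps power2_eq_square)
    with Suc show ?case by simp
  qed simp
  from this[of "N - 1"] show ?thesis
    by (cases N) (auto intro: order_trans)
qed

text \<open>Every positive \<open>n \<le> N\<close> is a product of distinct primes up to
  \<open>N\<close> times a square. So \<open>harm N\<close> is at most the product of all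
  \<open>1 + 1 / p\<close>, where \<open>1 + x \<le> exp x\<close> applies, times a sum of inverse
  squares.\<close>

lemma harm_le_two_exp_sum_inverse_primes:
  "(harm N :: real) \<le> 2 * exp (\<Sum>p | prime p \<and> p \<le> N. 1 / real p)"
proof -
  define P where "P = {p::nat. prime p \<and> p \<le> N}"
  have fin: "finite P" unfolding P_def by simp
  \<comment> \<open>\<open>g\<close> encodes the squarefree part by its set of primes;
    \<open>f\<close> reads off \<open>1 / n\<close> from the code of \<open>n\<close>.\<close>
  define g where "g n = (prime_factors (squarefree_part n), square_part n)" for n :: nat
  define f where "f = (\<lambda>(S, m). (\<Prod>p\<in>S. 1 / real p) * (1 / (real m)\<^sup>2))"
  have sqf: "\<Prod>(prime_factors (squarefree_part n)) = squarefree_part n" for n :: nat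
  proof -
    have "(\<Prod>p\<in>prime_factors (squarefree_part n). p ^ multiplicity p (squarefree_part n))
        = squarefree_part n"
      by (simp add: prod_prime_factors)
    moreover have "multiplicity p (squarefree_part n) = 1"
      if "p \<in> prime_factors (squarefree_part n)" for p
      using that squarefree_factorial_semiring'[of "squarefree_part n"] by simp
    ultimately show ?thesis by simp
  qed
  have dec: "n = \<Prod>(fst (g n)) * (snd (g n))\<^sup>2" for n
    using squarefree_decompose[of n] by (simp add: g_def sqf)
  have inj: "inj_on g {1..N}"
    by (rule inj_on_inverseI[where g = "\<lambda>x. \<Prod>(fst x) * (snd x)\<^sup>2"]) (use dec in simp)
  have img: "g ` {1..N} \<subseteq> Pow P \<times> {1..N}"
  proof
    fix x assume "x \<in> g ` {1..N}"
    then obtain n where n: "n \<in> {1..N}" and x: "x = g n" by auto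
    have "square_part n dvd n" "squarefree_part n dvd n"
      using squarefree_decompose[of n]
      by (metis dvd_mult dvd_power zero_less_numeral, metis dvd_triv_left)
    moreover from this n have "square_part n > 0" by (auto intro: gr0I)
    ultimately have "square_part n \<le> N" "squarefree_part n \<le> N" "square_part n \<ge> 1"
      using n by (auto dest!: dvd_imp_le)
    then show "x \<in> Pow P \<times> {1..N}"
      by (auto simp: x g_def P_def prime_factors_dvd dest!: dvd_imp_le[OF _ gr0I])
  qed
  have val: "inverse (real n) = f (g n)" for n
  proof -
    have "real n = (\<Prod>p\<in>fst (g n). real p) * (real (snd (g n)))\<^sup>2"
      by (subst dec[of n]) simp
    then show ?thesis
      by (simp add: f_def case_prod_beta prod_dividef field_simps)
  qed
  have "harm N = (\<Sum>x\<in>g ` {1..N}. f x)"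
    unfolding harm_def using inj by (simp add: sum.reindex val)
  also have "\<dots> \<le> (\<Sum>x\<in>Pow P \<times> {1..N}. f x)"
    using img fin by (intro sum_mono2) (auto simp: f_def intro!: divide_nonneg_nonneg prod_nonneg)
  also have "\<dots> = (\<Sum>S\<in>Pow P. \<Prod>p\<in>S. 1 / real p) * (\<Sum>m=1..N. 1 / (real m)\<^sup>2)"
    by (simp add: f_def sum.cartesian_product sum_product)
  \<comment> \<open>A subset \<open>S\<close> records the factors from which \<open>1 / p\<close>
    rather than 1 is chosen.\<close>
  also have "(\<Sum>S\<in>Pow P. \<Prod>p\<in>S. 1 / real p) = (\<Prod>p\<in>P. 1 / real p + 1)"
    using fin by (subst prod_add) auto
  also have "\<dots> * (\<Sum>m=1..N. 1 / (real m)\<^sup>2) \<le> (\<Prod>p\<in>P. exp (1 / real p)) * 2"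
    by (intro mult_mono prod_mono sum_inverse_squares_le_2)
       (auto intro!: sum_nonneg prod_nonneg simp: add.commute exp_ge_add_one_self)
  finally show ?thesis using fin by (simp add: exp_sum P_def mult.commute)
qed

text \<open>A weak lower half of Mertens' second theorem: take logarithms in the harmonic bound. The
  loss of 1 comes from \<open>2 \<le> exp 1\<close>.\<close>

lemma ln_ln_le_sum_inverse_primes:
  assumes "N > 1"
  shows "ln (ln (real N)) - 1 \<le> (\<Sum>p | prime p \<and> p \<le> N. 1 / real p)"
proof -
  let ?A = "\<Sum>p | prime p \<and> p \<le> N. 1 / real p"
  have "ln (real N) \<le> ln (real N + 1)" using assms by simp
  also have "\<dots> \<le> harm N" by (rule ln_le_harm)
  also have "\<dots> \<le> 2 * exp ?A" by (rule harm_le_two_exp_sum_inverse_primes)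
  also have "\<dots> \<le> exp 1 * exp ?A" using exp_ge_add_one_self[of 1] by simp
  also have "\<dots> = exp (1 + ?A)" by (simp add: exp_add)
  finally have "ln (ln (real N)) \<le> ln (exp (1 + ?A))"
    using assms by (subst ln_le_cancel_iff) auto
  then show ?thesis by simp
qed

section \<open>Chebyshev's inequality and the constants\<close>

theorem theorem3:
  fixes \<epsilon> :: real and N :: nat
  assumes "0 < \<epsilon>" and "\<epsilon> < 1"
    and "real N \<ge> exp (exp (1.842 / \<epsilon>))"
  shows "real (card {n \<in> {1..N}. real (tau n) \<ge> ln (real N) powr (ln 2 * (1 - \<epsilon>))})
           \<ge> real N * (1 - 85.165 / (\<epsilon>\<^sup>2 * ln (ln (real N))))"
proof -
  define L where "L = ln (ln (real N))"
  define P where "P = {p::nat. prime p \<and> p \<le> N}"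
  define A where "A = (\<Sum>p\<in>P. 1 / real p)"
  define good where "good = {n \<in> {1..N}. real (tau n) \<ge> ln (real N) powr (ln 2 * (1 - \<epsilon>))}"
  have lnN: "ln (real N) \<ge> exp (1.842 / \<epsilon>)"
    using assms(3) by (metis exp_gt_zero less_le_trans ln_ge_iff)
  then have lnN_pos: "ln (real N) > 0" using exp_gt_zero less_le_trans by blast
  then have N1: "N > 1" by (cases "N \<le> 1") (auto simp: le_Suc_eq)
  have "L \<ge> 1.842 / \<epsilon>" unfolding L_def using lnN lnN_pos by (simp add: ln_ge_iff)
  then have L_pos: "L > 0" using assms(1) by (intro less_le_trans[of 0 "1.842 / \<epsilon>" L]) simp_all
  show ?thesis
  proof (cases "\<epsilon>\<^sup>2 * L \<le> 85.165")
    \<comment> \<open>The claimed lower bound is not positive here.\<close>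
    case True
    then have "1 - 85.165 / (\<epsilon>\<^sup>2 * L) \<le> 0"
      using L_pos assms(1) by (simp add: field_simps)
    then have "real N * (1 - 85.165 / (\<epsilon>\<^sup>2 * L)) \<le> 0"
      by (simp add: mult_nonneg_nonpos)
    then show ?thesis unfolding L_def by linarith
  next
    case False
    \<comment> \<open>The distance from the approximate mean \<open>A\<close> down to the threshold
      for the number of prime divisors.\<close>
    define d where "d = A - (1 - \<epsilon>) * L"
    define bad where "bad = {1..N} - good"
    have "\<epsilon>\<^sup>2 * L \<le> \<epsilon> * L"
      using assms L_pos by (simp add: power2_eq_square)
    with False have eL: "\<epsilon> * L > 85" by simp
    have "A \<ge> L - 1"
      using ln_ln_le_sum_inverse_primes[OF N1] by (simp add: A_def P_def L_def)
    \<comment> \<open>\<open>d \<ge> \<epsilon> * L - 1\<close>, and the 1 is below a tenth of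
      \<open>\<epsilon> * L > 85\<close>.\<close>
    then have d: "d \<ge> 0.9 * (\<epsilon> * L)"
      using eL by (simp add: d_def algebra_simps)
    with eL have d_pos: "d > 0" by linarith
    have small: "real (card {p \<in> P. p dvd n}) \<le> (1 - \<epsilon>) * L" if n: "n \<in> bad" for n
    proof (rule ccontr)
      assume *: "\<not> ?thesis"
      from n have "1 \<le> n" "n \<le> N" by (auto simp: bad_def)
      then have "{p \<in> P. p dvd n} = prime_factors n"
        by (auto simp: P_def prime_factors_dvd dest: dvd_imp_le)
      with * have "(1 - \<epsilon>) * L \<le> real (card (prime_factors n))" by simp
      then have "2 powr ((1 - \<epsilon>) * L) \<le> 2 powr real (card (prime_factors n))"
        by simp
      also have "\<dots> = real (2 ^ card (prime_factors n))" by (simp add: powr_realpow)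
      also have "\<dots> \<le> real (tau n)"
        using two_power_card_prime_factors_le_tau[of n] \<open>1 \<le> n\<close> by (simp only: of_nat_le_iff)
      \<comment> \<open>Both sides are \<open>exp (ln 2 * (1 - \<epsilon>) * L)\<close>, as
        \<open>L = ln (ln N)\<close>.\<close>
      also have "2 powr ((1 - \<epsilon>) * L) = ln (real N) powr (ln 2 * (1 - \<epsilon>))"
        using lnN_pos by (simp add: powr_def L_def mult_ac)
      finally show False using n by (auto simp: bad_def good_def)
    qed
    \<comment> \<open>Chebyshev's inequality: every bad \<open>n\<close> contributes at least
      \<open>d\<^sup>2\<close> to the second moment.\<close>
    have "real (card bad) * d\<^sup>2 = (\<Sum>n\<in>bad. d\<^sup>2)" by simp
    also have "\<dots> \<le> (\<Sum>n\<in>bad. (real (card {p \<in> P. p dvd n}) - A)\<^sup>2)"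
    proof (rule sum_mono)
      fix n assume "n \<in> bad"
      then have "d \<le> A - real (card {p \<in> P. p dvd n})" using small by (simp add: d_def)
      then have "d\<^sup>2 \<le> (A - real (card {p \<in> P. p dvd n}))\<^sup>2"
        using d_pos by (intro power_mono) auto
      then show "d\<^sup>2 \<le> (real (card {p \<in> P. p dvd n}) - A)\<^sup>2"
        by (simp add: power2_commute)
    qed
    also have "\<dots> \<le> (\<Sum>n=1..N. (real (card {p \<in> P. p dvd n}) - A)\<^sup>2)"
      by (rule sum_mono2) (auto simp: bad_def)
    also have "\<dots> \<le> 3 * real N * A"
      unfolding A_def by (rule turan_inequality) (simp add: P_def)
    also have "\<dots> \<le> real N * (85.165 / (\<epsilon>\<^sup>2 * L)) * d\<^sup>2"
    proof -
      have "3 * A * (\<epsilon>\<^sup>2 * L) \<le> 3 * d * (\<epsilon>\<^sup>2 * L) + 3 * (\<epsilon> * L)\<^sup>2"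
      proof -
        have "A \<le> d + L" using assms L_pos by (simp add: d_def algebra_simps)
        then have "3 * A * (\<epsilon>\<^sup>2 * L) \<le> 3 * (d + L) * (\<epsilon>\<^sup>2 * L)"
          using L_pos by (intro mult_right_mono) auto
        then show ?thesis by (simp add: algebra_simps power2_eq_square)
      qed
      \<comment> \<open>Since \<open>d \<ge> 0.9 * (\<epsilon> * L)\<close>, both
        \<open>\<epsilon>\<^sup>2 * L\<close> and \<open>\<epsilon> * L\<close> are at most
        \<open>2 * d\<close>. The total is \<open>18 * d\<^sup>2\<close>, well below the allowed
        constant.\<close>
      also have "\<dots> \<le> 3 * d * (2 * d) + 3 * (2 * d)\<^sup>2"
        using d d_pos eL \<open>\<epsilon>\<^sup>2 * L \<le> \<epsilon> * L\<close>
        by (intro add_mono mult_left_mono power_mono) auto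
      also have "\<dots> \<le> 85.165 * d\<^sup>2" by (simp add: power2_eq_square)
      finally have "3 * A \<le> 85.165 / (\<epsilon>\<^sup>2 * L) * d\<^sup>2"
        using L_pos assms(1) by (simp add: field_simps)
      then have "real N * (3 * A) \<le> real N * (85.165 / (\<epsilon>\<^sup>2 * L) * d\<^sup>2)"
        by (intro mult_left_mono) auto
      then show ?thesis by (simp only: mult_ac)
    qed
    finally have "real (card bad) \<le> real N * (85.165 / (\<epsilon>\<^sup>2 * L))"
      using d_pos by (simp only: mult_le_cancel_right_pos zero_less_power)
    moreover have "good \<subseteq> {1..N}" by (auto simp: good_def)
    then have "card bad = N - card good" "card good \<le> N"
      using card_Diff_subset[of good "{1..N}"] card_mono[of "{1..N}" good]
      by (auto simp: bad_def intro: finite_subset)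
    ultimately show ?thesis
      unfolding good_def[symmetric] L_def[symmetric] by (simp add: algebra_simps of_nat_diff)
  qed
qed

end
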